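(* Let $I,\alpha$ be any pair consisting of an interpretation $I$ and a variable assignment $\alpha$ into $I$, and let $C_s$ be any set of constraints. If a constraint solving rule (one of (Equals), (Feat), (FeatExists), (Subset), (TransConj), (TransClos), (Cycle), (DomPrec)) transforms $C_s$ to $C'_s$, then $$I,\alpha\models C_s \quad\text{if and only if}\quad I,\alpha\models C'_s.$$
   Context: **Syntax.** Fix a set $\mathcal V$ of variables and two disjoint sets of symbols: $\mathcal F$ (relation symbols) and $\mathcal P$ (irreflexive relation symbols). For variables $x,y$, symbols $f,g\in\mathcal F$ and $p\in\mathcal P$, the constraints are the formal expressions - $x=y$ (equality), - $x=f:y$ (feature constraint), - $x=\exists f:y$ (set membership), - $x=\exists p^{+}:y$ (transitive closure) and $x=\exists p^{*}:y$ (reflexive-transitive closure), - $x=f:\supseteq g(y)$ (subset inclusion), - $x=[f\ p\ 1]\,y$ (first daughter), - $f(x):p^{+}:g(y)$ and $f(x):p^{*}:g(y)$ (domain precedence), and conjunctions of these. A set of constraints is identified with the conjunction of its members. **Semantics.** An interpretation $I$ consists of a nonempty set $U^I$, a binary relation $f^I\subseteq U^I\times U^I$ for each $f\in\mathcal F$, and a binary relation $p^I\subseteq U^I\times U^I$ for each $p\in\mathcal P$ such that the transitive closure $(p^I)^+$ is irreflexive. $(p^I)^*$ is the reflexive-transitive closure of $p^I$. Write $f^I(e)=\{e'\in U^I : (e,e')\in f^I\}$. A variable assignment is a function $\alpha:\mathcal V\to U^I$. Satisfaction: - $I,\alpha\models x=y$ iff $\alpha(x)=\alpha(y)$; - $I,\alpha\models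 x=f:y$ iff $f^I(\alpha(x))=\{\alpha(y)\}$; - $I,\alpha\models x=\exists f:y$ iff $(\alpha(x),\alpha(y))\in f^I$; - $I,\alpha\models x=\exists p^{+}:y$ iff $(\alpha(x),\alpha(y))\in(p^I)^+$; - $I,\alpha\models x=\exists p^{*}:y$ iff $(\alpha(x),\alpha(y))\in(p^I)^*$; - $I,\alpha\models x=f:\supseteq g(y)$ iff $f^I(\alpha(x))\supseteq g^I(\alpha(y))$; - $I,\alpha\models x=[f\ p\ 1]\,y$ iff $\alpha(y)\in f^I(\alpha(x))$ and $(\alpha(y),e)\in(p^I)^*$ for all $e\in f^I(\alpha(x))$; - $I,\alpha\models f(x):p^{+}:g(y)$ iff $(e_1,e_2)\in(p^I)^+$ for all $e_1\in f^I(\alpha(x))$, $e_2\in g^I(\alpha(y))$; - $I,\alpha\models f(x):p^{*}:g(y)$ iff $(e_1,e_2)\in(p^I)^*$ for all $e_1\in f^I(\alpha(x))$, $e_2\in g^I(\alpha(y))$; - $I,\alpha\models\phi\ \&\ \psi$ iff $I,\alpha\models\phi$ and $I,\alpha\models\psi$. **Constraint solving rules.** Each rule transforms the constraint system on the left of $\longmapsto$ into the one on the right. Within the rules, $D$ denotes the remaining constraints of the system, and $[x/y]D$ is $D$ with every occurrence of $x$ replaced by $y$. - (Equals): $x=y\wedge D\ \longmapsto\ x=y\wedge[x/y]D$, if $x\neq y$ and $x$ occurs in $D$. - (Feat): $x=f:y\wedge x=f:z\wedge D\ \longmapsto\ x=f:y\wedge y=z\wedge D$. - (FeatExists): $x=f:y\wedge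 x=\exists f:z\wedge D\ \longmapsto\ x=f:y\wedge x=\exists f:z\wedge y=z\wedge D$. - (Subset): $x=f:\supseteq g(y)\wedge y=G:z\wedge D\ \longmapsto\ x=\exists f:z\wedge x=f:\supseteq g(y)\wedge y=G:z\wedge D$, if $(x=\exists f:z)\notin D$, where $G$ ranges over $g,\exists g$. - (TransConj): $x=\exists p^{*}:y\wedge x=\exists p^{+}:y\wedge D\ \longmapsto\ x=\exists p^{+}:y\wedge D$. - (TransClos): $x=\exists R_1:y\wedge y=\exists R_2:z\wedge D\ \longmapsto\ x=\exists(R_1\times R_2):z\wedge x=\exists R_1:y\wedge y=\exists R_2:z\wedge D$, if $(x=\exists p^{+}:z)\notin D$ and $(x=\exists(R_1\times R_2):z)\notin D$, where $R_1,R_2\in\{p^+,p^*\}$, $p^*\times p^*=p^*$ and the other three products equal $p^+$. - (Cycle): $x=\exists p^{*}:y\wedge y=\exists p^{*}:x\wedge D\ \longmapsto\ x=y\wedge D$. - (DomPrec): $f(x):R:g(y)\wedge x=\exists f:x_1\wedge y=\exists g:y_1\wedge D\ \longmapsto\ x_1=\exists R:y_1\wedge f(x):R:g(y)\wedge x=\exists f:x_1\wedge y=\exists g:y_1\wedge D$, if $(x_1=\exists p^{+}:y_1)\notin D$ and $(x_1=\exists R:y_1)\notin D$, where $R$ ranges over $p^+,p^*$. *)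

theory Defs
  imports Main
begin

datatype mode = Plus | Star

(* The disjoint symbol sets F and P are the types 'f and 'p; the mode of Clos and Prec selects
   between p^+ and p^*. *)
datatype (vars: 'v, dead 'f, dead 'p) constraint =
    Eq 'v 'v                       \<comment> \<open>x = y\<close>
  | Feat 'v 'f 'v                  \<comment> \<open>x = f : y\<close>
  | Ex 'v 'f 'v                    \<comment> \<open>x = \<exists>f : y\<close>
  | Clos 'v 'p mode 'v             \<comment> \<open>x = \<exists>p^m : y\<close>
  | Supset 'v 'f 'f 'v             \<comment> \<open>x = f :\<supseteq> g(y)\<close>
  | First 'v 'f 'p 'v              \<comment> \<open>x = [f p 1] y\<close>
  | Prec 'f 'v 'p mode 'f 'v       \<comment> \<open>f(x) : p^m : g(y)\<close>
  | And "('v, 'f, 'p) constraint" "('v, 'f, 'p) constraint"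
  for map: map_vars

record ('f, 'p, 'u) interp =
  univ :: "'u set"
  feat :: "'f \<Rightarrow> 'u rel"
  prec :: "'p \<Rightarrow> 'u rel"

definition is_interp :: "('f, 'p, 'u) interp \<Rightarrow> bool" where
  "is_interp I \<longleftrightarrow> univ I \<noteq> {}
     \<and> (\<forall>f. feat I f \<subseteq> univ I \<times> univ I)
     \<and> (\<forall>p. prec I p \<subseteq> univ I \<times> univ I \<and> irrefl ((prec I p)\<^sup>+))"

definition is_assignment :: "('f, 'p, 'u) interp \<Rightarrow> ('v \<Rightarrow> 'u) \<Rightarrow> bool" where
  "is_assignment I \<alpha> \<longleftrightarrow> (\<forall>x. \<alpha> x \<in> univ I)"

definition feat_vals :: "('f, 'p, 'u) interp \<Rightarrow> 'f \<Rightarrow> 'u \<Rightarrow> 'u set" where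
  "feat_vals I f e = {e' \<in> univ I. (e, e') \<in> feat I f}"

(* For Star this is reflexive on the whole type 'u, not only on univ I. The difference is
   invisible below, where only pairs of elements of univ I are tested for membership. *)
fun clos :: "('f, 'p, 'u) interp \<Rightarrow> 'p \<Rightarrow> mode \<Rightarrow> 'u rel" where
  "clos I p Plus = (prec I p)\<^sup>+"
| "clos I p Star = (prec I p)\<^sup>*"

primrec sat :: "('f, 'p, 'u) interp \<Rightarrow> ('v \<Rightarrow> 'u) \<Rightarrow> ('v, 'f, 'p) constraint \<Rightarrow> bool" where
  "sat I \<alpha> (Eq x y) \<longleftrightarrow> \<alpha> x = \<alpha> y"
| "sat I \<alpha> (Feat x f y) \<longleftrightarrow> feat_vals I f (\<alpha> x) = {\<alpha> y}"
| "sat I \<alpha> (Ex x f y) \<longleftrightarrow> (\<alpha> x, \<alpha> y) \<in> feat I f"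
| "sat I \<alpha> (Clos x p m y) \<longleftrightarrow> (\<alpha> x, \<alpha> y) \<in> clos I p m"
| "sat I \<alpha> (Supset x f g y) \<longleftrightarrow> feat_vals I f (\<alpha> x) \<supseteq> feat_vals I g (\<alpha> y)"
| "sat I \<alpha> (First x f p y) \<longleftrightarrow>
     \<alpha> y \<in> feat_vals I f (\<alpha> x) \<and> (\<forall>e \<in> feat_vals I f (\<alpha> x). (\<alpha> y, e) \<in> clos I p Star)"
| "sat I \<alpha> (Prec f x p m g y) \<longleftrightarrow>
     (\<forall>e\<^sub>1 \<in> feat_vals I f (\<alpha> x). \<forall>e\<^sub>2 \<in> feat_vals I g (\<alpha> y). (e\<^sub>1, e\<^sub>2) \<in> clos I p m)"
| "sat I \<alpha> (And \<phi> \<psi>) \<longleftrightarrow> sat I \<alpha> \<phi> \<and> sat I \<alpha> \<psi>"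

definition sat_set ::
  "('f, 'p, 'u) interp \<Rightarrow> ('v \<Rightarrow> 'u) \<Rightarrow> ('v, 'f, 'p) constraint set \<Rightarrow> bool" where
  "sat_set I \<alpha> C \<longleftrightarrow> (\<forall>\<phi> \<in> C. sat I \<alpha> \<phi>)"

fun conjuncts :: "('v, 'f, 'p) constraint \<Rightarrow> ('v, 'f, 'p) constraint set" where
  "conjuncts (And \<phi> \<psi>) = conjuncts \<phi> \<union> conjuncts \<psi>"
| "conjuncts \<phi> = {\<phi>}"

definition system :: "('v, 'f, 'p) constraint set \<Rightarrow> ('v, 'f, 'p) constraint set" where
  "system C = (\<Union>\<phi>\<in>C. conjuncts \<phi>)"

(* [x/y]D: here x is the variable that disappears. *)
definition replace ::
  "'v \<Rightarrow> 'v \<Rightarrow> ('v, 'f, 'p) constraint set \<Rightarrow> ('v, 'f, 'p) constraint set" where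
  "replace x y D = map_vars (id(x := y)) ` D"

fun mode_prod :: "mode \<Rightarrow> mode \<Rightarrow> mode" where
  "mode_prod Star Star = Star"
| "mode_prod _ _ = Plus"

(* solving_rule L D R: a rule rewrites the system L \<union> D to R, where L are the constraints it
   matches and D the remaining ones. *)
inductive solving_rule ::
  "('v, 'f, 'p) constraint set \<Rightarrow> ('v, 'f, 'p) constraint set \<Rightarrow> ('v, 'f, 'p) constraint set \<Rightarrow> bool"
where
  Equals: "\<lbrakk>x \<noteq> y; x \<in> (\<Union>\<phi>\<in>D. vars \<phi>)\<rbrakk> \<Longrightarrow>
    solving_rule {Eq x y} D ({Eq x y} \<union> replace x y D)"
| Feat: "solving_rule {Feat x f y, Feat x f z} D ({Feat x f y, Eq y z} \<union> D)"
| FeatExists: "solving_rule {Feat x f y, Ex x f z} D ({Feat x f y, Ex x f z, Eq y z} \<union> D)"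
| Subset: "\<lbrakk>G \<in> {Feat y g z, Ex y g z}; Ex x f z \<notin> D\<rbrakk> \<Longrightarrow>
    solving_rule {Supset x f g y, G} D ({Ex x f z, Supset x f g y, G} \<union> D)"
| TransConj: "solving_rule {Clos x p Star y, Clos x p Plus y} D ({Clos x p Plus y} \<union> D)"
| TransClos: "\<lbrakk>Clos x p Plus z \<notin> D; Clos x p (mode_prod m\<^sub>1 m\<^sub>2) z \<notin> D\<rbrakk> \<Longrightarrow>
    solving_rule {Clos x p m\<^sub>1 y, Clos y p m\<^sub>2 z} D
      ({Clos x p (mode_prod m\<^sub>1 m\<^sub>2) z, Clos x p m\<^sub>1 y, Clos y p m\<^sub>2 z} \<union> D)"
| Cycle: "solving_rule {Clos x p Star y, Clos y p Star x} D ({Eq x y} \<union> D)"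
| DomPrec: "\<lbrakk>Clos x\<^sub>1 p Plus y\<^sub>1 \<notin> D; Clos x\<^sub>1 p m y\<^sub>1 \<notin> D\<rbrakk> \<Longrightarrow>
    solving_rule {Prec f x p m g y, Ex x f x\<^sub>1, Ex y g y\<^sub>1} D
      ({Clos x\<^sub>1 p m y\<^sub>1, Prec f x p m g y, Ex x f x\<^sub>1, Ex y g y\<^sub>1} \<union> D)"

(* A set of constraints is identified with the conjunction of its members, so rules match and
   produce sets up to nesting of conjunctions. *)
definition transforms ::
  "('v, 'f, 'p) constraint set \<Rightarrow> ('v, 'f, 'p) constraint set \<Rightarrow> bool" where
  "transforms C C' \<longleftrightarrow>
     (\<exists>L D. system C = L \<union> D \<and> L \<inter> D = {} \<and> solving_rule L D (system C'))"

end

theory Submission imports Defs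
begin

text \<open>Every rule is sound for each fixed assignment: what it adds follows from what it
  matches, what it drops follows from what it keeps, and \<open>D\<close> stays except under
  (Equals). There \<open>x = y\<close> makes renaming harmless (\<open>sat_set_replace\<close>).
  (TransClos) composes paths (\<open>clos_trans\<close>), and (Cycle) is antisymmetry of the star
  (\<open>clos_Star_antisym\<close>). Feature rules reduce to membership in sets of feature
  values.\<close>

lemma sat_map_vars: "sat I \<alpha> (map_vars s \<phi>) \<longleftrightarrow> sat I (\<alpha> \<circ> s) \<phi>"
  by (induction \<phi>) simp_all

text \<open>Renaming variables amounts to precomposing \<alpha> with the renaming, and \<alpha>
  already identifies \<open>x\<close> and \<open>y\<close>.\<close>

lemma sat_set_replace:
  assumes "\<alpha> x = \<alpha> y"
  shows "sat_set I \<alpha> (replace x y D) \<longleftrightarrow> sat_set I \<alpha> D"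
proof -
  have "\<alpha> \<circ> id(x := y) = \<alpha>"
    using assms by auto
  then show ?thesis
    by (simp add: sat_set_def replace_def sat_map_vars)
qed

lemma sat_set_Un: "sat_set I \<alpha> (C \<union> D) \<longleftrightarrow> sat_set I \<alpha> C \<and> sat_set I \<alpha> D"
  by (auto simp: sat_set_def)

lemma sat_set_insert: "sat_set I \<alpha> (insert \<phi> C) \<longleftrightarrow> sat I \<alpha> \<phi> \<and> sat_set I \<alpha> C"
  by (simp add: sat_set_def)

lemma sat_set_empty: "sat_set I \<alpha> {}"
  by (simp add: sat_set_def)

lemma sat_set_conjuncts: "sat_set I \<alpha> (conjuncts \<phi>) \<longleftrightarrow> sat I \<alpha> \<phi>"
  by (induction \<phi>) (simp_all add: sat_set_Un sat_set_insert sat_set_empty)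

text \<open>Carries the result for flattened systems, on which the rules act, back to arbitrary
  sets.\<close>

lemma sat_set_system: "sat_set I \<alpha> (system C) \<longleftrightarrow> sat_set I \<alpha> C"
proof -
  have "sat_set I \<alpha> (system C) \<longleftrightarrow> (\<forall>\<phi>\<in>C. sat_set I \<alpha> (conjuncts \<phi>))"
    by (auto simp: sat_set_def system_def)
  then show ?thesis
    by (simp only: sat_set_conjuncts) (simp add: sat_set_def)
qed

text \<open>Links \<open>Ex\<close>, which speaks of pairs, to the constraints on value sets;
  features relate only elements of the universe.\<close>

lemma mem_feat_vals:
  assumes "is_interp I"
  shows "e' \<in> feat_vals I f e \<longleftrightarrow> (e, e') \<in> feat I f"
  using assms by (auto simp: is_interp_def feat_vals_def)

lemma clos_Plus_imp_Star: "ab \<in> clos I p Plus \<Longrightarrow> ab \<in> clos I p Star"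
  by (cases ab) (simp add: trancl_into_rtrancl)

lemma clos_trans:
  assumes "(a, b) \<in> clos I p m\<^sub>1" and "(b, c) \<in> clos I p m\<^sub>2"
  shows "(a, c) \<in> clos I p (mode_prod m\<^sub>1 m\<^sub>2)"
  using assms
  by (cases m\<^sub>1; cases m\<^sub>2)
    (auto dest: trancl_trans rtrancl_trans trancl_rtrancl_trancl rtrancl_trancl_trancl)

text \<open>Paths both ways between distinct points would compose to a nonempty cycle, against
  irreflexivity of the transitive closure.\<close>

lemma clos_Star_antisym:
  assumes "is_interp I" and "(a, b) \<in> clos I p Star" and "(b, a) \<in> clos I p Star"
  shows "a = b"
proof (rule ccontr)
  assume "a \<noteq> b"
  then have "(a, b) \<in> (prec I p)\<^sup>+"
    using assms(2) by (simp add: rtrancl_eq_or_trancl)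
  then have "(a, a) \<in> (prec I p)\<^sup>+"
    using assms(3) by (simp add: trancl_rtrancl_trancl)
  then show False
    using assms(1) by (auto simp: is_interp_def irrefl_def)
qed

lemma solving_rule_sound:
  assumes I: "is_interp I" and rule: "solving_rule L D R"
  shows "sat_set I \<alpha> (L \<union> D) \<longleftrightarrow> sat_set I \<alpha> R"
proof -
  note sat_set_simps = sat_set_Un sat_set_insert sat_set_empty
  \<comment> \<open>Keeps \<open>clos\<close> folded so that the lemmas about it match the
    goals.\<close>
  note [simp del] = clos.simps
  show ?thesis
    using rule
  proof cases
    case (Equals x y)
    then show ?thesis
      using sat_set_replace[of \<alpha> x y I D] by (auto simp: sat_set_simps)
  next
    case (Feat x f y z)
    have "sat_set I \<alpha> {Feat x f y, Feat x f z} \<longleftrightarrow> sat_set I \<alpha> {Feat x f y, Eq y z}"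
      unfolding sat_set_simps sat.simps by (metis singleton_inject)
    then show ?thesis
      unfolding Feat by (simp only: sat_set_Un)
  next
    case (FeatExists x f y z)
    \<comment> \<open>The flipped rule reads \<open>Ex\<close> as membership in the value set, which
      \<open>Feat\<close> makes a singleton.\<close>
    then show ?thesis
      by (auto simp: sat_set_simps simp flip: mem_feat_vals[OF I])
  next
    case (Subset G y g z x f)
    \<comment> \<open>Either form of \<open>G\<close> puts the value of \<open>z\<close> among the
      \<open>g\<close>-values of \<open>y\<close>.\<close>
    then show ?thesis
      by (auto simp: sat_set_simps simp flip: mem_feat_vals[OF I])
  next
    case (TransConj x p y)
    then show ?thesis
      by (auto simp: sat_set_simps clos_Plus_imp_Star)
  next
    case (TransClos x p z m\<^sub>1 m\<^sub>2 y)
    then show ?thesis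
      using clos_trans[of "\<alpha> x" "\<alpha> y" I p m\<^sub>1 "\<alpha> z" m\<^sub>2] by (auto simp: sat_set_simps)
  next
    case (Cycle x p y)
    \<comment> \<open>Left to right is reflexivity of the star, visible once \<open>clos\<close> is
      unfolded.\<close>
    have "\<alpha> x = \<alpha> y \<longleftrightarrow> (\<alpha> x, \<alpha> y) \<in> clos I p Star \<and> (\<alpha> y, \<alpha> x) \<in> clos I p Star"
      using clos_Star_antisym[OF I] by (auto simp: clos.simps)
    with Cycle show ?thesis
      by (auto simp: sat_set_simps)
  next
    case (DomPrec x\<^sub>1 p y\<^sub>1 m f x g y)
    \<comment> \<open>The two \<open>Ex\<close> constraints supply the elements at which
      \<open>Prec\<close> is instantiated.\<close>
    then show ?thesis
      by (auto simp: sat_set_simps simp flip: mem_feat_vals[OF I])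
  qed
qed

theorem theorem1:
  fixes I :: "('f, 'p, 'u) interp" and \<alpha> :: "'v \<Rightarrow> 'u"
    and C C' :: "('v, 'f, 'p) constraint set"
  assumes "is_interp I" and "is_assignment I \<alpha>" and "transforms C C'"
  shows "sat_set I \<alpha> C \<longleftrightarrow> sat_set I \<alpha> C'"
proof -
  obtain L D where "system C = L \<union> D" and "solving_rule L D (system C')"
    using assms(3) by (auto simp: transforms_def)
  then have "sat_set I \<alpha> (system C) \<longleftrightarrow> sat_set I \<alpha> (system C')"
    using solving_rule_sound[OF assms(1)] by metis
  then show ?thesis
    by (simp only: sat_set_system)
qed

end
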